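(* Let $A_1,\dots,A_n$ be closed first-order formulas, let $\overline{\sigma}$ be a tuple of fresh Skolem constants, let $F[\overline{\sigma},y]$ be a formula whose only free variable is $y$, let $C_1,\dots,C_m$ be clauses, and let $\mathrm{ans}$ be a fresh uninterpreted unary predicate symbol (the answer predicate) that occurs in none of $A_1,\dots,A_n$, $F$, $C_1,\dots,C_m$. Let $C$ be a clause not containing an answer literal, and let $r[\overline{\sigma}]$ be a term. Suppose that, using a saturation algorithm based on a sound inference system $\mathcal{I}$, the clause $C\lor \mathrm{ans}(r[\overline{\sigma}])$ is derived from the set of clauses consisting of the (clausified) initial assumptions $A_1,\dots,A_n$, the clauses of $\mathrm{cnf}(\lnot F[\overline{\sigma}, y]\lor\mathrm{ans}(y))$, and the additional assumptions $C_1,\dots,C_m$. Then \[A_1,\dots,A_n,C_1,\dots,C_m\vdash C, F[\overline{\sigma}, r[\overline{\sigma}]],\] i.e. $A_1\land\dots\land A_n\land C_1\land\dots\land C_m\rightarrow C\lor F[\overline{\sigma},r[\overline{\sigma}]]$ is valid. That is, under the assumptions $C_1,\dots,C_m,\lnot C$, the term $r[\overline{\sigma}]$ provides a definite answer to the specification $A_1\land\dots\land A_n\rightarrow\forall\overline{x}.\exists y.F[\overline{x},y]$.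
   Context: Formulas and clauses with free variables are implicitly universally quantified. $\mathrm{cnf}(G)$ denotes the clausal normal form of $G$. An inference system is sound if the conclusion of each inference is a logical consequence of its premises. A clause is derived from a set $S$ by saturation based on $\mathcal{I}$ if it is obtained from $S$ by finitely many applications of inference rules of $\mathcal{I}$ (each applied to clauses in $S$ or previously derived). An answer literal is a literal with predicate $\mathrm{ans}$. The notation $F_1,\dots,F_k\vdash G_1,\dots,G_l$ means that $F_1\land\dots\land F_k\rightarrow G_1\lor\dots\lor G_l$ is valid.
   Formalization: Added assumption: C, r and C_1,…,C_m contain no Skolem symbols introduced by clausifying the A_i or ¬F∨ans(y). Without it the claim fails: A_1=∃x.Q(x), F=Q(y) derives ans(sk), but ∃x.Q(x)⊢Q(sk) is not valid. *)

theory Defs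
  imports Main "HOL-Library.Multiset"
begin

section \<open>First-order logic with equality\<close>

text \<open>
  Variables are de Bruijn indices: \<open>Var n\<close> below \<open>k\<close> quantifiers is bound if \<open>n < k\<close> and otherwise
  denotes the free variable \<open>n - k\<close>. Symbols carry no arity; a constant is a function symbol
  applied to the empty list.
\<close>

datatype (funs_tm: 'f) tm = Var nat | Fun 'f "'f tm list"

datatype (funs_at: 'f, preds_at: 'p) atom = Pred 'p "'f tm list" | Eq "'f tm" "'f tm"

datatype (funs_fm: 'f, preds_fm: 'p) fm =
    Atom "('f, 'p) atom"
  | Neg "('f, 'p) fm"
  | And "('f, 'p) fm" "('f, 'p) fm"
  | Or "('f, 'p) fm" "('f, 'p) fm"
  | Imp "('f, 'p) fm" "('f, 'p) fm"
  | Iff "('f, 'p) fm" "('f, 'p) fm"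
  | Forall "('f, 'p) fm"
  | Exists "('f, 'p) fm"

datatype (funs_lit: 'f, preds_lit: 'p) literal = LPos "('f, 'p) atom" | LNeg "('f, 'p) atom"

type_synonym ('f, 'p) clause = "('f, 'p) literal multiset"

definition funs_cl :: "('f, 'p) clause \<Rightarrow> 'f set" where
  "funs_cl C = (\<Union>L\<in>set_mset C. funs_lit L)"

definition preds_cl :: "('f, 'p) clause \<Rightarrow> 'p set" where
  "preds_cl C = (\<Union>L\<in>set_mset C. preds_lit L)"

fun vars_tm :: "'f tm \<Rightarrow> nat set" where
  "vars_tm (Var n) = {n}"
| "vars_tm (Fun f ts) = (\<Union>t\<in>set ts. vars_tm t)"

fun vars_at :: "('f, 'p) atom \<Rightarrow> nat set" where
  "vars_at (Pred p ts) = (\<Union>t\<in>set ts. vars_tm t)"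
| "vars_at (Eq s t) = vars_tm s \<union> vars_tm t"

fun vars_lit :: "('f, 'p) literal \<Rightarrow> nat set" where
  "vars_lit (LPos a) = vars_at a"
| "vars_lit (LNeg a) = vars_at a"

definition vars_cls :: "('f, 'p) clause set \<Rightarrow> nat set" where
  "vars_cls N = (\<Union>C\<in>N. \<Union>L\<in>set_mset C. vars_lit L)"

fun fv :: "('f, 'p) fm \<Rightarrow> nat set" where
  "fv (Atom a) = vars_at a"
| "fv (Neg A) = fv A"
| "fv (And A B) = fv A \<union> fv B"
| "fv (Or A B) = fv A \<union> fv B"
| "fv (Imp A B) = fv A \<union> fv B"
| "fv (Iff A B) = fv A \<union> fv B"
| "fv (Forall A) = {n. Suc n \<in> fv A}"
| "fv (Exists A) = {n. Suc n \<in> fv A}"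


section \<open>Substitution\<close>

fun subst_tm :: "(nat \<Rightarrow> 'f tm) \<Rightarrow> 'f tm \<Rightarrow> 'f tm" where
  "subst_tm s (Var n) = s n"
| "subst_tm s (Fun f ts) = Fun f (map (subst_tm s) ts)"

fun subst_at :: "(nat \<Rightarrow> 'f tm) \<Rightarrow> ('f, 'p) atom \<Rightarrow> ('f, 'p) atom" where
  "subst_at s (Pred p ts) = Pred p (map (subst_tm s) ts)"
| "subst_at s (Eq t u) = Eq (subst_tm s t) (subst_tm s u)"

definition lift_subst :: "(nat \<Rightarrow> 'f tm) \<Rightarrow> nat \<Rightarrow> 'f tm" where
  "lift_subst s = case_nat (Var 0) (\<lambda>n. subst_tm (\<lambda>i. Var (Suc i)) (s n))"

fun subst :: "(nat \<Rightarrow> 'f tm) \<Rightarrow> ('f, 'p) fm \<Rightarrow> ('f, 'p) fm" where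
  "subst s (Atom a) = Atom (subst_at s a)"
| "subst s (Neg A) = Neg (subst s A)"
| "subst s (And A B) = And (subst s A) (subst s B)"
| "subst s (Or A B) = Or (subst s A) (subst s B)"
| "subst s (Imp A B) = Imp (subst s A) (subst s B)"
| "subst s (Iff A B) = Iff (subst s A) (subst s B)"
| "subst s (Forall A) = Forall (subst (lift_subst s) A)"
| "subst s (Exists A) = Exists (subst (lift_subst s) A)"

text \<open>The body \<open>A\<close> of a quantified formula, with \<open>t\<close> for the variable bound by that quantifier.\<close>

definition inst :: "('f, 'p) fm \<Rightarrow> 'f tm \<Rightarrow> ('f, 'p) fm" where
  "inst A t = subst (case_nat t Var) A"

definition subst_var :: "nat \<Rightarrow> 'f tm \<Rightarrow> ('f, 'p) fm \<Rightarrow> ('f, 'p) fm" where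
  "subst_var y t A = subst (Var(y := t)) A"

text \<open>Simultaneous replacement of the free variables \<open>xs\<close> by the constants \<open>cs\<close>.\<close>

definition subst_consts :: "nat list \<Rightarrow> 'f list \<Rightarrow> ('f, 'p) fm \<Rightarrow> ('f, 'p) fm" where
  "subst_consts xs cs A =
     subst (\<lambda>n. case map_of (zip xs cs) n of Some c \<Rightarrow> Fun c [] | None \<Rightarrow> Var n) A"


section \<open>Semantics\<close>

text \<open>The domain of an interpretation is the whole (nonempty) type \<open>'d\<close>.\<close>

record ('f, 'p, 'd) interp =
  fun_of :: "'f \<Rightarrow> 'd list \<Rightarrow> 'd"
  pred_of :: "'p \<Rightarrow> 'd list \<Rightarrow> bool"

fun eval :: "('f, 'p, 'd) interp \<Rightarrow> (nat \<Rightarrow> 'd) \<Rightarrow> 'f tm \<Rightarrow> 'd" where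
  "eval M e (Var n) = e n"
| "eval M e (Fun f ts) = fun_of M f (map (eval M e) ts)"

fun holds_at :: "('f, 'p, 'd) interp \<Rightarrow> (nat \<Rightarrow> 'd) \<Rightarrow> ('f, 'p) atom \<Rightarrow> bool" where
  "holds_at M e (Pred p ts) \<longleftrightarrow> pred_of M p (map (eval M e) ts)"
| "holds_at M e (Eq t u) \<longleftrightarrow> eval M e t = eval M e u"

fun holds :: "('f, 'p, 'd) interp \<Rightarrow> (nat \<Rightarrow> 'd) \<Rightarrow> ('f, 'p) fm \<Rightarrow> bool" where
  "holds M e (Atom a) \<longleftrightarrow> holds_at M e a"
| "holds M e (Neg A) \<longleftrightarrow> \<not> holds M e A"
| "holds M e (And A B) \<longleftrightarrow> holds M e A \<and> holds M e B"
| "holds M e (Or A B) \<longleftrightarrow> holds M e A \<or> holds M e B"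
| "holds M e (Imp A B) \<longleftrightarrow> (holds M e A \<longrightarrow> holds M e B)"
| "holds M e (Iff A B) \<longleftrightarrow> (holds M e A \<longleftrightarrow> holds M e B)"
| "holds M e (Forall A) \<longleftrightarrow> (\<forall>d. holds M (case_nat d e) A)"
| "holds M e (Exists A) \<longleftrightarrow> (\<exists>d. holds M (case_nat d e) A)"

fun holds_lit :: "('f, 'p, 'd) interp \<Rightarrow> (nat \<Rightarrow> 'd) \<Rightarrow> ('f, 'p) literal \<Rightarrow> bool" where
  "holds_lit M e (LPos a) \<longleftrightarrow> holds_at M e a"
| "holds_lit M e (LNeg a) \<longleftrightarrow> \<not> holds_at M e a"

definition holds_cl :: "('f, 'p, 'd) interp \<Rightarrow> (nat \<Rightarrow> 'd) \<Rightarrow> ('f, 'p) clause \<Rightarrow> bool" where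
  "holds_cl M e C \<longleftrightarrow> (\<exists>L\<in>#C. holds_lit M e L)"

text \<open>Truth of a formula or clause with its free variables implicitly universally quantified.\<close>

definition models_fm :: "('f, 'p, 'd) interp \<Rightarrow> ('f, 'p) fm \<Rightarrow> bool" where
  "models_fm M A \<longleftrightarrow> (\<forall>e. holds M e A)"

definition models_cl :: "('f, 'p, 'd) interp \<Rightarrow> ('f, 'p) clause \<Rightarrow> bool" where
  "models_cl M C \<longleftrightarrow> (\<forall>e. holds_cl M e C)"


section \<open>Clausal normal form\<close>

fun nnf :: "('f, 'p) fm \<Rightarrow> ('f, 'p) fm" and nnf_neg :: "('f, 'p) fm \<Rightarrow> ('f, 'p) fm" where
  "nnf (Atom a) = Atom a"
| "nnf (Neg A) = nnf_neg A"
| "nnf (And A B) = And (nnf A) (nnf B)"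
| "nnf (Or A B) = Or (nnf A) (nnf B)"
| "nnf (Imp A B) = Or (nnf_neg A) (nnf B)"
| "nnf (Iff A B) = And (Or (nnf_neg A) (nnf B)) (Or (nnf A) (nnf_neg B))"
| "nnf (Forall A) = Forall (nnf A)"
| "nnf (Exists A) = Exists (nnf A)"
| "nnf_neg (Atom a) = Neg (Atom a)"
| "nnf_neg (Neg A) = nnf A"
| "nnf_neg (And A B) = Or (nnf_neg A) (nnf_neg B)"
| "nnf_neg (Or A B) = And (nnf_neg A) (nnf_neg B)"
| "nnf_neg (Imp A B) = And (nnf A) (nnf_neg B)"
| "nnf_neg (Iff A B) = And (Or (nnf A) (nnf B)) (Or (nnf_neg A) (nnf_neg B))"
| "nnf_neg (Forall A) = Exists (nnf_neg A)"
| "nnf_neg (Exists A) = Forall (nnf_neg A)"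

text \<open>
  The variables of \<open>M\<close> that stem from universal quantifiers of \<open>A\<close> are renamed apart from all
  variables of \<open>B\<close> and its clauses \<open>N\<close>, and vice versa.
\<close>

definition apart ::
  "('f, 'p) fm \<Rightarrow> ('f, 'p) clause set \<Rightarrow> ('f, 'p) fm \<Rightarrow> ('f, 'p) clause set \<Rightarrow> bool" where
  "apart A M B N \<longleftrightarrow>
     (vars_cls M - fv A) \<inter> (vars_cls N \<union> fv B) = {} \<and>
     (vars_cls N - fv B) \<inter> (vars_cls M \<union> fv A) = {}"

text \<open>
  \<open>clausify S A N\<close>: Skolemizing the formula \<open>A\<close> in negation normal form, dropping its universal
  quantifiers and distributing disjunction over conjunction yields the clauses \<open>N\<close>; \<open>S\<close> is the
  set of Skolem symbols introduced, one for each existential quantifier. It is a relation because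
  the names of Skolem symbols and variables and the order of Skolem arguments are left open.
\<close>

inductive clausify :: "'f set \<Rightarrow> ('f, 'p) fm \<Rightarrow> ('f, 'p) clause set \<Rightarrow> bool" where
  pos: "clausify {} (Atom a) {{#LPos a#}}"
| neg: "clausify {} (Neg (Atom a)) {{#LNeg a#}}"
| conj: "clausify S (And A B) (M \<union> N)"
    if "clausify S1 A M" "clausify S2 B N" "S1 \<inter> S2 = {}" "S = S1 \<union> S2" "apart A M B N"
| disj: "clausify S (Or A B) {C + D |C D. C \<in> M \<and> D \<in> N}"
    if "clausify S1 A M" "clausify S2 B N" "S1 \<inter> S2 = {}" "S = S1 \<union> S2" "apart A M B N"
| all: "clausify S (Forall A) N"
    if "z \<notin> fv (Forall A)" "clausify S (inst A (Var z)) N"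
| ex: "clausify (insert f S) (Exists A) N"
    if "f \<notin> S" "distinct zs" "set zs = fv (Exists A)"
      "clausify S (inst A (Fun f (map Var zs))) N"

text \<open>
  \<open>N\<close> is a clausal normal form of \<open>G\<close>. Every model of \<open>G\<close> satisfies \<open>N\<close> after a suitable
  reinterpretation of \<open>S\<close>, so a consequence of \<open>N\<close> is in general a consequence of \<open>G\<close> only if it
  does not mention \<open>S\<close>.
\<close>

definition is_cnf :: "'f set \<Rightarrow> ('f, 'p) fm \<Rightarrow> ('f, 'p) clause set \<Rightarrow> bool" where
  "is_cnf S G N \<longleftrightarrow> clausify S (nnf G) N \<and> S \<inter> funs_fm G = {}"

text \<open>Clausification of a list of formulas, with pairwise disjoint sets of Skolem symbols.\<close>

inductive is_cnf_list :: "'f set \<Rightarrow> ('f, 'p) fm list \<Rightarrow> ('f, 'p) clause set \<Rightarrow> bool" where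
  Nil: "is_cnf_list {} [] {}"
| Cons: "is_cnf_list (S \<union> S') (G # Gs) (N \<union> N')"
    if "is_cnf S G N" "is_cnf_list S' Gs N'" "S \<inter> S' = {}"


section \<open>Inference systems and derivations\<close>

text \<open>An inference system is the set of its inferences \<open>(premises, conclusion)\<close>.\<close>

type_synonym ('f, 'p) inference_system = "(('f, 'p) clause list \<times> ('f, 'p) clause) set"

text \<open>
  HOL cannot quantify over types inside a definition, so soundness refers to interpretations with
  a given domain type.
\<close>

definition sound :: "'d itself \<Rightarrow> ('f, 'p) inference_system \<Rightarrow> bool" where
  "sound _ \<I> \<longleftrightarrow>
     (\<forall>(Ps, D) \<in> \<I>. \<forall>M :: ('f, 'p, 'd) interp. (\<forall>P\<in>set Ps. models_cl M P) \<longrightarrow> models_cl M D)"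

inductive derivable ::
  "('f, 'p) inference_system \<Rightarrow> ('f, 'p) clause set \<Rightarrow> ('f, 'p) clause \<Rightarrow> bool"
  for \<I> N where
  initial: "D \<in> N \<Longrightarrow> derivable \<I> N D"
| infer: "(Ps, D) \<in> \<I> \<Longrightarrow> (\<And>P. P \<in> set Ps \<Longrightarrow> derivable \<I> N P) \<Longrightarrow> derivable \<I> N D"

end

theory Submission
  imports Defs
begin

text \<open>
  Let \<open>M\<close> be a model of the assumptions, and let \<open>F'\<close> be \<open>F\<close> with the Skolem constants plugged in.
  Since \<open>ans\<close> is fresh, it can be reinterpreted in \<open>M\<close> as the set of all \<open>d\<close> with \<open>F'[d]\<close>, which
  makes \<open>\<not> F'[y] \<or> ans(y)\<close> true. Reinterpreting the symbols introduced by Skolemization then makes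
  all initial clauses true, so by soundness \<open>C \<or> ans(r)\<close> is true. Neither \<open>C\<close> nor \<open>r\<close> mentions a
  reinterpreted symbol, and \<open>ans(r)\<close> means \<open>F'[r]\<close>.
\<close>

section \<open>Coincidence and substitution\<close>

lemma eval_cong:
  assumes "\<And>f. f \<in> funs_tm t \<Longrightarrow> fun_of M f = fun_of M' f"
    and "\<And>n. n \<in> vars_tm t \<Longrightarrow> e n = e' n"
  shows "eval M e t = eval M' e' t"
  using assms
proof (induction t)
  case (Fun f ts)
  have "eval M e t = eval M' e' t" if "t \<in> set ts" for t
    using Fun.IH[OF that] Fun.prems that by fastforce
  then have "map (eval M e) ts = map (eval M' e') ts" by simp
  moreover have "fun_of M f = fun_of M' f" using Fun.prems(1) by simp
  ultimately show ?case by (simp only: eval.simps)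
qed simp

lemma holds_at_cong:
  assumes "\<And>f. f \<in> funs_at a \<Longrightarrow> fun_of M f = fun_of M' f"
    and "\<And>p. p \<in> preds_at a \<Longrightarrow> pred_of M p = pred_of M' p"
    and "\<And>n. n \<in> vars_at a \<Longrightarrow> e n = e' n"
  shows "holds_at M e a \<longleftrightarrow> holds_at M' e' a"
proof (cases a)
  case (Pred p ts)
  have "eval M e t = eval M' e' t" if "t \<in> set ts" for t
    by (rule eval_cong) (use assms that Pred in auto)
  then have "map (eval M e) ts = map (eval M' e') ts" by simp
  moreover have "pred_of M p = pred_of M' p" using assms(2) Pred by simp
  ultimately show ?thesis using Pred by (simp only: holds_at.simps)
next
  case (Eq s t)
  have "eval M e s = eval M' e' s" "eval M e t = eval M' e' t"
    by (rule eval_cong; use assms Eq in auto)+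
  then show ?thesis using Eq by simp
qed

lemma holds_cong:
  assumes "\<And>f. f \<in> funs_fm A \<Longrightarrow> fun_of M f = fun_of M' f"
    and "\<And>p. p \<in> preds_fm A \<Longrightarrow> pred_of M p = pred_of M' p"
    and "\<And>n. n \<in> fv A \<Longrightarrow> e n = e' n"
  shows "holds M e A \<longleftrightarrow> holds M' e' A"
  using assms
proof (induction A arbitrary: e e')
  case (Atom a)
  then show ?case using holds_at_cong[of a M M' e e'] by simp
next
  case (Neg A)
  then show ?case using Neg.IH[of e e'] by simp
next
  case (And A B)
  then show ?case using And.IH[of e e'] by simp
next
  case (Or A B)
  then show ?case using Or.IH[of e e'] by simp
next
  case (Imp A B)
  then show ?case using Imp.IH[of e e'] by simp
next
  case (Iff A B)
  then show ?case using Iff.IH[of e e'] by simp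
next
  case (Forall A)
  have "holds M (case_nat d e) A \<longleftrightarrow> holds M' (case_nat d e') A" for d
    by (rule Forall.IH) (use Forall.prems in \<open>auto split: nat.split\<close>)
  then show ?case by simp
next
  case (Exists A)
  have "holds M (case_nat d e) A \<longleftrightarrow> holds M' (case_nat d e') A" for d
    by (rule Exists.IH) (use Exists.prems in \<open>auto split: nat.split\<close>)
  then show ?case by simp
qed

lemma holds_lit_cong:
  assumes "\<And>f. f \<in> funs_lit L \<Longrightarrow> fun_of M f = fun_of M' f"
    and "\<And>p. p \<in> preds_lit L \<Longrightarrow> pred_of M p = pred_of M' p"
  shows "holds_lit M e L \<longleftrightarrow> holds_lit M' e L"
  using assms holds_at_cong[of _ M M' e e] by (cases L) auto

lemma holds_cl_cong:
  assumes "\<And>f. f \<in> funs_cl C \<Longrightarrow> fun_of M f = fun_of M' f"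
    and "\<And>p. p \<in> preds_cl C \<Longrightarrow> pred_of M p = pred_of M' p"
  shows "holds_cl M e C \<longleftrightarrow> holds_cl M' e C"
proof -
  have "holds_lit M e L \<longleftrightarrow> holds_lit M' e L" if "L \<in># C" for L
    by (rule holds_lit_cong) (use assms that in \<open>auto simp: funs_cl_def preds_cl_def\<close>)
  then show ?thesis by (auto simp: holds_cl_def)
qed

section \<open>Semantic substitution lemmas\<close>

lemma eval_subst_tm: "eval M e (subst_tm s t) = eval M (\<lambda>n. eval M e (s n)) t"
proof (induction t)
  case (Fun f ts)
  then have "map (eval M e) (map (subst_tm s) ts) = map (eval M (\<lambda>n. eval M e (s n))) ts" by simp
  then show ?case by (simp only: subst_tm.simps eval.simps)
qed simp

lemma holds_subst_at: "holds_at M e (subst_at s a) \<longleftrightarrow> holds_at M (\<lambda>n. eval M e (s n)) a"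
  by (cases a) (simp_all add: eval_subst_tm comp_def)

text \<open>Shifting the terms of \<open>s\<close> by one makes them ignore the new value
  \<open>d\<close>. This carries the induction for \<open>holds_subst\<close> under a
  quantifier.\<close>

lemma eval_lift_subst:
  "(\<lambda>n. eval M (case_nat d e) (lift_subst s n)) = case_nat d (\<lambda>n. eval M e (s n))"
  by (auto simp: lift_subst_def eval_subst_tm fun_eq_iff split: nat.split)

lemma holds_subst: "holds M e (subst s A) \<longleftrightarrow> holds M (\<lambda>n. eval M e (s n)) A"
  by (induction A arbitrary: e s) (simp_all add: holds_subst_at eval_lift_subst)

lemma holds_inst: "holds M e (inst A t) \<longleftrightarrow> holds M (case_nat (eval M e t) e) A"
proof -
  have "(\<lambda>n. eval M e (case_nat t Var n)) = case_nat (eval M e t) e"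
    by (auto simp: fun_eq_iff split: nat.split)
  then show ?thesis by (simp add: inst_def holds_subst)
qed

lemma holds_subst_var: "holds M e (subst_var y t A) \<longleftrightarrow> holds M (e(y := eval M e t)) A"
proof -
  have "(\<lambda>n. eval M e ((Var(y := t)) n)) = e(y := eval M e t)"
    by auto
  then show ?thesis by (simp add: subst_var_def holds_subst)
qed

section \<open>Symbols and variables after substitution\<close>

lemma funs_subst_tm: "funs_tm (subst_tm s t) \<subseteq> funs_tm t \<union> (\<Union>n. funs_tm (s n))"
  by (induction t) auto

lemma funs_subst_at: "funs_at (subst_at s a) \<subseteq> funs_at a \<union> (\<Union>n. funs_tm (s n))"
  using funs_subst_tm[of s] by (cases a) fastforce+

lemma funs_lift_subst: "(\<Union>n. funs_tm (lift_subst s n)) \<subseteq> (\<Union>n. funs_tm (s n))"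
  using funs_subst_tm[of "\<lambda>i. Var (Suc i)"]
  by (fastforce simp: lift_subst_def split: nat.splits)

lemma funs_subst: "funs_fm (subst s A) \<subseteq> funs_fm A \<union> (\<Union>n. funs_tm (s n))"
proof (induction A arbitrary: s)
  case (Atom a)
  then show ?case using funs_subst_at[of s a] by simp
next
  case (Forall A)
  then show ?case using Forall.IH[of "lift_subst s"] funs_lift_subst[of s] by auto
next
  case (Exists A)
  then show ?case using Exists.IH[of "lift_subst s"] funs_lift_subst[of s] by auto
qed fastforce+

lemma funs_inst: "funs_fm (inst A t) \<subseteq> funs_fm A \<union> funs_tm t"
  using funs_subst[of "case_nat t Var" A] by (auto simp: inst_def split: nat.splits)

lemma funs_subst_consts: "funs_fm (subst_consts xs cs A) \<subseteq> funs_fm A \<union> set cs"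
proof -
  have "funs_tm (case map_of (zip xs cs) n of Some c \<Rightarrow> Fun c [] | None \<Rightarrow> Var n) \<subseteq> set cs" for n
    by (auto split: option.splits dest!: map_of_SomeD set_zip_rightD)
  then show ?thesis
    using funs_subst[of "\<lambda>n. case map_of (zip xs cs) n of Some c \<Rightarrow> Fun c [] | None \<Rightarrow> Var n" A]
    unfolding subst_consts_def by blast
qed

lemma preds_subst_at: "preds_at (subst_at s a) = preds_at a"
  by (cases a) auto

lemma preds_subst: "preds_fm (subst s A) = preds_fm A"
  by (induction A arbitrary: s) (auto simp: preds_subst_at)

text \<open>Equal lengths keep \<open>zip\<close> from truncating, so each variable in
  \<open>xs\<close> really becomes a constant, whose value ignores the environment. Only the
  variables in \<open>V\<close> can still matter.\<close>

lemma holds_subst_consts_cong: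
  assumes "fv A \<subseteq> V \<union> set xs" "length cs = length xs" "\<And>n. n \<in> V \<Longrightarrow> e n = e' n"
  shows "holds M e (subst_consts xs cs A) \<longleftrightarrow> holds M e' (subst_consts xs cs A)"
proof -
  have "eval M e (case map_of (zip xs cs) n of Some c \<Rightarrow> Fun c [] | None \<Rightarrow> Var n) =
        eval M e' (case map_of (zip xs cs) n of Some c \<Rightarrow> Fun c [] | None \<Rightarrow> Var n)"
    if "n \<in> fv A" for n
  proof (cases "n \<in> set xs")
    case True
    then have "n \<in> dom (map_of (zip xs cs))" using assms(2) by simp
    then show ?thesis by auto
  next
    case False
    then show ?thesis using that assms(1,3) by (auto split: option.split)
  qed
  then show ?thesis
    unfolding subst_consts_def holds_subst by (intro holds_cong) auto
qed

section \<open>Clausal normal form\<close>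

lemma holds_nnf:
  "holds M e (nnf A) \<longleftrightarrow> holds M e A"
  "holds M e (nnf_neg A) \<longleftrightarrow> \<not> holds M e A"
  by (induction A arbitrary: e) auto

lemma funs_nnf: "funs_fm (nnf A) \<subseteq> funs_fm A" "funs_fm (nnf_neg A) \<subseteq> funs_fm A"
  by (induction A) auto

text \<open>This bound shows that clauses already made true survive a later reinterpretation of
  other Skolem symbols.\<close>

lemma funs_clausify: "clausify S A N \<Longrightarrow> D \<in> N \<Longrightarrow> funs_cl D \<subseteq> funs_fm A \<union> S"
proof (induction arbitrary: D rule: clausify.induct)
  case (disj S1 A M S2 B N S)
  then obtain E E' where "D = E + E'" "E \<in> M" "E' \<in> N" by auto
  then show ?case using disj.IH(1)[of E] disj.IH(2)[of E'] disj.hyps by (auto simp: funs_cl_def)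
next
  case (all z A S N)
  then show ?case using all.IH[of D] funs_inst[of A "Var z"] by auto
next
  case (ex f S zs A N)
  then show ?case using ex.IH[of D] funs_inst[of A "Fun f (map Var zs)"] by auto
qed (fastforce simp: funs_cl_def)+

text \<open>Skolemization introduces function symbols only, so the predicates stay fixed.\<close>

definition agree_off :: "'f set \<Rightarrow> ('f, 'p, 'd) interp \<Rightarrow> ('f, 'p, 'd) interp \<Rightarrow> bool" where
  "agree_off S M M' \<longleftrightarrow> pred_of M' = pred_of M \<and> (\<forall>f. f \<notin> S \<longrightarrow> fun_of M' f = fun_of M f)"

lemma agree_off_trans:
  "agree_off S M M' \<Longrightarrow> agree_off S' M' M'' \<Longrightarrow> agree_off (S \<union> S') M M''"
  by (auto simp: agree_off_def)

lemma agree_off_holds: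
  "agree_off S M M' \<Longrightarrow> S \<inter> funs_fm A = {} \<Longrightarrow> holds M e A \<longleftrightarrow> holds M' e A"
  by (rule holds_cong) (auto simp: agree_off_def)

lemma agree_off_holds_cl:
  "agree_off S M M' \<Longrightarrow> S \<inter> funs_cl C = {} \<Longrightarrow> holds_cl M e C \<longleftrightarrow> holds_cl M' e C"
  by (rule holds_cl_cong) (auto simp: agree_off_def)

text \<open>The values of \<open>zs\<close> determine which witnesses \<open>d\<close> make
  \<open>A\<close> true, so a witness can be chosen as a function \<open>g\<close> of these values.
  Interpreting \<open>f\<close> as \<open>g\<close> leaves the truth of \<open>A\<close> unchanged
  because \<open>f\<close> does not occur in it.\<close>

lemma skolem_function:
  assumes "f \<notin> funs_fm A" "fv (Exists A) \<subseteq> set zs"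
  obtains M' where "agree_off {f} M M'"
    "\<And>e. holds M e (Exists A) \<Longrightarrow> holds M' e (inst A (Fun f (map Var zs)))"
proof -
  \<comment> \<open>\<open>env ds\<close> rebuilds an environment from the arguments of the Skolem
    function. Its unspecified values outside \<open>zs\<close> are never seen by
    \<open>A\<close>.\<close>
  define env where "env ds n = the (map_of (zip zs ds) n)" for ds :: "'c list" and n
  define g where "g ds = (SOME d. holds M (case_nat d (env ds)) A)" for ds
  define M' where "M' = M\<lparr>fun_of := (fun_of M)(f := g)\<rparr>"
  have agree: "agree_off {f} M M'" by (auto simp: agree_off_def M'_def)
  have "holds M' e (inst A (Fun f (map Var zs)))" if "holds M e (Exists A)" for e
  proof -
    let ?env = "env (map e zs)"
    have env: "?env n = e n" if "n \<in> fv (Exists A)" for n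
      using that assms(2) by (auto simp: env_def map_of_zip_map)
    have A_env: "holds M (case_nat d ?env) A \<longleftrightarrow> holds M (case_nat d e) A" for d
      by (rule holds_cong) (use env in \<open>auto split: nat.split\<close>)
    have "\<exists>d. holds M (case_nat d ?env) A" using that A_env by simp
    then have "holds M (case_nat (g (map e zs)) ?env) A"
      unfolding g_def by (rule someI_ex)
    then have "holds M' (case_nat (g (map e zs)) e) A"
      using A_env agree_off_holds[OF agree] assms(1) by auto
    then show ?thesis by (simp add: holds_inst M'_def comp_def)
  qed
  with agree that show thesis by blast
qed

text \<open>The shared core of conjunction and disjunction: reinterpret first \<open>S1\<close>,
  then \<open>S2\<close>. The first change does not touch \<open>B\<close>, and the second does not
  touch the clauses in \<open>K\<close>, whose symbols come from \<open>A\<close> and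
  \<open>S1\<close>. The assumptions \<open>A\<close> and \<open>B\<close> have the shape of the
  induction hypotheses of \<open>clausify_sat\<close>.\<close>

lemma clausify_sat_pair:
  fixes M :: "('f, 'p, 'd) interp"
  assumes "clausify S1 A K" "(S1 \<union> S2) \<inter> (funs_fm A \<union> funs_fm B) = {}" "S1 \<inter> S2 = {}"
    and A: "\<And>M :: ('f, 'p, 'd) interp. S1 \<inter> funs_fm A = {} \<Longrightarrow>
      \<exists>M'. agree_off S1 M M' \<and> (\<forall>e. holds M e A \<longrightarrow> (\<forall>D\<in>K. holds_cl M' e D))"
    and B: "\<And>M :: ('f, 'p, 'd) interp. S2 \<inter> funs_fm B = {} \<Longrightarrow>
      \<exists>M'. agree_off S2 M M' \<and> (\<forall>e. holds M e B \<longrightarrow> (\<forall>D\<in>N. holds_cl M' e D))"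
  shows "\<exists>M'. agree_off (S1 \<union> S2) M M' \<and>
    (\<forall>e. (holds M e A \<longrightarrow> (\<forall>D\<in>K. holds_cl M' e D)) \<and>
         (holds M e B \<longrightarrow> (\<forall>D\<in>N. holds_cl M' e D)))"
proof -
  have disjoint: "S1 \<inter> funs_fm A = {}" "S1 \<inter> funs_fm B = {}" "S2 \<inter> funs_fm A = {}"
    "S2 \<inter> funs_fm B = {}"
    using assms(2) by auto
  obtain M1 where M1: "agree_off S1 M M1" "\<forall>e. holds M e A \<longrightarrow> (\<forall>D\<in>K. holds_cl M1 e D)"
    using A disjoint by blast
  obtain M2 where M2: "agree_off S2 M1 M2" "\<forall>e. holds M1 e B \<longrightarrow> (\<forall>D\<in>N. holds_cl M2 e D)"
    using B disjoint by blast
  have "holds_cl M1 e D \<longleftrightarrow> holds_cl M2 e D" if "D \<in> K" for e D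
    using agree_off_holds_cl[OF M2(1)] funs_clausify[OF assms(1) that] disjoint assms(3)
    by blast
  moreover have "holds M e B \<longleftrightarrow> holds M1 e B" for e
    using agree_off_holds[OF M1(1)] disjoint by blast
  ultimately show ?thesis
    using M1(2) M2(2) agree_off_trans[OF M1(1) M2(1)] by (intro exI[of _ M2]) auto
qed

text \<open>
  The implication is kept at each single environment: this is what makes the case of disjunction
  go through, where it depends on the environment which disjunct is true.
\<close>

lemma clausify_sat:
  assumes "clausify S A N" "S \<inter> funs_fm A = {}"
  shows "\<exists>M'. agree_off S M M' \<and> (\<forall>e. holds M e A \<longrightarrow> (\<forall>D\<in>N. holds_cl M' e D))"
  using assms
proof (induction arbitrary: M rule: clausify.induct)
  case (pos a)
  then show ?case by (intro exI[of _ M]) (auto simp: agree_off_def holds_cl_def)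
next
  case (neg a)
  then show ?case by (intro exI[of _ M]) (auto simp: agree_off_def holds_cl_def)
next
  case (conj S1 A K S2 B N S)
  have "(S1 \<union> S2) \<inter> (funs_fm A \<union> funs_fm B) = {}" using conj.prems conj.hyps by auto
  from clausify_sat_pair[OF conj.hyps(1) this conj.hyps(3) conj.IH, of M]
  show ?case using conj.hyps(4) by auto
next
  case (disj S1 A K S2 B N S)
  have "(S1 \<union> S2) \<inter> (funs_fm A \<union> funs_fm B) = {}" using disj.prems disj.hyps by auto
  from clausify_sat_pair[OF disj.hyps(1) this disj.hyps(3) disj.IH, of M]
  obtain M' where "agree_off S M M'"
    "\<forall>e. (holds M e A \<longrightarrow> (\<forall>D\<in>K. holds_cl M' e D)) \<and>
         (holds M e B \<longrightarrow> (\<forall>D\<in>N. holds_cl M' e D))"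
    using disj.hyps(4) by auto
  moreover have "holds_cl M' e (D + E) \<longleftrightarrow> holds_cl M' e D \<or> holds_cl M' e E" for e D E
    by (auto simp: holds_cl_def)
  ultimately show ?case by (intro exI[of _ M']) auto
next
  case (all z A S N)
  then have "S \<inter> funs_fm (inst A (Var z)) = {}" using funs_inst[of A "Var z"] by auto
  then obtain M' where "agree_off S M M'"
    "\<forall>e. holds M e (inst A (Var z)) \<longrightarrow> (\<forall>D\<in>N. holds_cl M' e D)"
    using all.IH by blast
  \<comment> \<open>A universal formula true at \<open>e\<close> has its body true with the bound
    variable set to \<open>e z\<close>.\<close>
  then show ?case by (intro exI[of _ M']) (auto simp: holds_inst)
next
  case (ex f S zs A N)
  \<comment> \<open>First \<open>f\<close> is turned into a Skolem function. The symbols in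
    \<open>S\<close> can be reinterpreted afterwards because neither \<open>A\<close> nor the Skolem
    term contains any of them.\<close>
  have "f \<notin> funs_fm A" "fv (Exists A) \<subseteq> set zs" using ex by auto
  then obtain M1 where M1: "agree_off {f} M M1"
    "\<And>e. holds M e (Exists A) \<Longrightarrow> holds M1 e (inst A (Fun f (map Var zs)))"
    using skolem_function[where M = M] by blast
  have "S \<inter> funs_fm (inst A (Fun f (map Var zs))) = {}"
    using funs_inst[of A "Fun f (map Var zs)"] ex.hyps ex.prems by auto
  then obtain M2 where M2: "agree_off S M1 M2"
    "\<forall>e. holds M1 e (inst A (Fun f (map Var zs))) \<longrightarrow> (\<forall>D\<in>N. holds_cl M2 e D)"
    using ex.IH by blast
  then show ?case using M1(2) agree_off_trans[OF M1(1) M2(1)] by (intro exI[of _ M2]) auto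
qed

section \<open>Models of clausal normal forms\<close>

lemma is_cnf_sat:
  assumes "is_cnf S G N" "models_fm M G"
  obtains M' where "agree_off S M M'" "\<forall>D\<in>N. models_cl M' D"
proof -
  have "clausify S (nnf G) N" "S \<inter> funs_fm (nnf G) = {}"
    using assms(1) funs_nnf(1)[of G] by (auto simp: is_cnf_def)
  then obtain M' where "agree_off S M M'"
    "\<forall>e. holds M e (nnf G) \<longrightarrow> (\<forall>D\<in>N. holds_cl M' e D)"
    using clausify_sat by blast
  then show thesis using assms(2) that by (auto simp: models_fm_def models_cl_def holds_nnf)
qed

lemma funs_is_cnf: "is_cnf S G N \<Longrightarrow> D \<in> N \<Longrightarrow> funs_cl D \<subseteq> funs_fm G \<union> S"
  using funs_clausify[of S "nnf G" N D] funs_nnf(1)[of G] by (auto simp: is_cnf_def)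

text \<open>The formulas are treated one after another. Reinterpreting \<open>S\<close> keeps the
  remaining formulas true, since they avoid \<open>S\<close>; reinterpreting \<open>S'\<close> then
  keeps the clauses in \<open>N\<close> true, since their symbols come from \<open>G\<close> and
  \<open>S\<close>.\<close>

lemma is_cnf_list_sat:
  assumes "is_cnf_list S Gs N" "\<forall>G\<in>set Gs. S \<inter> funs_fm G = {}" "\<forall>G\<in>set Gs. models_fm M G"
  shows "\<exists>M'. agree_off S M M' \<and> (\<forall>D\<in>N. models_cl M' D)"
  using assms
proof (induction arbitrary: M rule: is_cnf_list.induct)
  case Nil
  then show ?case by (intro exI[of _ M]) (auto simp: agree_off_def)
next
  case (Cons S G N S' Gs N')
  obtain M1 where M1: "agree_off S M M1" "\<forall>D\<in>N. models_cl M1 D"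
    using is_cnf_sat[OF Cons.hyps(1)] Cons.prems(2) by auto
  have "models_fm M1 B" if "B \<in> set Gs" for B
  proof -
    have "S \<inter> funs_fm B = {}" using Cons.prems(1) that by auto
    then show ?thesis
      using agree_off_holds[OF M1(1)] Cons.prems(2) that by (auto simp: models_fm_def)
  qed
  moreover have "\<forall>B\<in>set Gs. S' \<inter> funs_fm B = {}" using Cons.prems(1) by auto
  ultimately obtain M2 where M2: "agree_off S' M1 M2" "\<forall>D\<in>N'. models_cl M2 D"
    using Cons.IH by blast
  have "models_cl M2 D" if "D \<in> N" for D
  proof -
    have "S' \<inter> funs_cl D = {}"
      using funs_is_cnf[OF Cons.hyps(1) that] Cons.hyps(3) Cons.prems(1) by auto
    then show ?thesis
      using agree_off_holds_cl[OF M2(1)] M1(2) that by (auto simp: models_cl_def)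
  qed
  then show ?case using M2(2) agree_off_trans[OF M1(1) M2(1)] by (intro exI[of _ M2]) auto
qed

section \<open>Answer literals\<close>

text \<open>Soundness speaks of each interpretation separately, so it can be applied to the one
  fixed \<open>M\<close> all along the derivation.\<close>

lemma derivable_sound:
  assumes "sound TYPE('d) \<I>" "derivable \<I> N D"
    and "\<forall>E\<in>N. models_cl (M :: ('f, 'p, 'd) interp) E"
  shows "models_cl M D"
  using assms(2)
proof induction
  case (initial D)
  then show ?case using assms(3) by blast
next
  case (infer Ps D)
  then show ?case using assms(1) unfolding sound_def by blast
qed

theorem theorem1:
  fixes As :: "('f, 'p) fm list"
    and F :: "('f, 'p) fm"
    and xs :: "nat list" and y :: nat
    and \<sigma>s :: "'f list"
    and Cs :: "('f, 'p) clause list"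
    and ans :: 'p
    and C :: "('f, 'p) clause"
    and r :: "'f tm"
    and \<I> :: "('f, 'p) inference_system"
    and SA SF :: "'f set"
    and NA NF :: "('f, 'p) clause set"
  assumes closed: "\<forall>A\<in>set As. fv A = {}"
    and F_vars: "distinct xs" "y \<notin> set xs" "fv F \<subseteq> insert y (set xs)"
    and sigma: "distinct \<sigma>s" "length \<sigma>s = length xs"
    and sigma_fresh: "\<forall>A\<in>set As. set \<sigma>s \<inter> funs_fm A = {}" "set \<sigma>s \<inter> funs_fm F = {}"
    and ans_fresh: "\<forall>A\<in>set As. ans \<notin> preds_fm A" "ans \<notin> preds_fm F"
      "\<forall>D\<in>set Cs. ans \<notin> preds_cl D"
    and C_no_ans: "ans \<notin> preds_cl C"
    and cnf_As: "is_cnf_list SA As NA"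
    and cnf_F: "is_cnf SF (Or (Neg (subst_consts xs \<sigma>s F)) (Atom (Pred ans [Var y]))) NF"
    and skolem_fresh: "SA \<inter> SF = {}"
      "\<forall>A\<in>set As. (SA \<union> SF) \<inter> funs_fm A = {}"
      "(SA \<union> SF) \<inter> (set \<sigma>s \<union> funs_fm F) = {}"
      "\<forall>D\<in>set Cs. (SA \<union> SF) \<inter> funs_cl D = {}"
    and no_skolem: "(SA \<union> SF) \<inter> (funs_cl C \<union> funs_tm r) = {}"
    and sound: "sound TYPE('d) \<I>"
    and derived: "derivable \<I> (NA \<union> NF \<union> set Cs) (add_mset (LPos (Pred ans [r])) C)"
  shows "\<forall>M :: ('f, 'p, 'd) interp.
           (\<forall>A\<in>set As. models_fm M A) \<and> (\<forall>D\<in>set Cs. models_cl M D) \<longrightarrow>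
           (\<forall>e. holds_cl M e C \<or> holds M e (subst_var y r (subst_consts xs \<sigma>s F)))"
proof (intro allI impI)
  fix M :: "('f, 'p, 'd) interp" and e
  assume M: "(\<forall>A\<in>set As. models_fm M A) \<and> (\<forall>D\<in>set Cs. models_cl M D)"
  let ?F = "subst_consts xs \<sigma>s F"
  let ?G = "Or (Neg ?F) (Atom (Pred ans [Var y]))"
  \<comment> \<open>The answer predicate takes one argument, hence \<open>hd ds\<close>. The
    environment \<open>e\<close> only fills in variables other than \<open>y\<close>, on which
    \<open>?F\<close> does not depend.\<close>
  define M' where
    "M' = M\<lparr>pred_of := (pred_of M)(ans := \<lambda>ds. holds M (e(y := hd ds)) ?F)\<rparr>"
  have F_M': "holds M' e' ?F \<longleftrightarrow> holds M e' ?F" for e'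
    by (rule holds_cong) (use ans_fresh(2) in \<open>auto simp: M'_def subst_consts_def preds_subst\<close>)
  \<comment> \<open>Once the constants are plugged in, at most \<open>y\<close> is free in
    \<open>?F\<close>. So the meaning given to \<open>ans\<close> through \<open>e\<close> is right
    at every environment \<open>e'\<close>, which is what makes \<open>?G\<close> true throughout
    \<open>M'\<close>.\<close>
  have F_env: "holds M e' ?F \<longleftrightarrow> holds M (e(y := e' y)) ?F" for e'
    by (rule holds_subst_consts_cong[where V = "{y}"]) (use F_vars(3) sigma(2) in auto)
  have "models_fm M' ?G"
    using F_M' F_env by (auto simp: models_fm_def M'_def)
  moreover have "models_fm M' A" if "A \<in> set As" for A
  proof -
    have "holds M' e' A \<longleftrightarrow> holds M e' A" for e'
      by (rule holds_cong) (use ans_fresh(1) that in \<open>auto simp: M'_def\<close>)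
    then show ?thesis using M that by (simp add: models_fm_def)
  qed
  \<comment> \<open>Treating \<open>?G\<close> as one more formula of the list yields a single
    reinterpretation for all Skolem symbols.\<close>
  moreover have "is_cnf_list (SF \<union> SA) (?G # As) (NF \<union> NA)"
    using is_cnf_list.Cons[OF cnf_F cnf_As] skolem_fresh(1) by blast
  moreover have "(SF \<union> SA) \<inter> funs_fm ?G = {}"
    using funs_subst_consts[of xs \<sigma>s F] skolem_fresh(3) by auto
  ultimately obtain M'' where M'': "agree_off (SF \<union> SA) M' M''"
    "\<forall>D\<in>NF \<union> NA. models_cl M'' D"
    using is_cnf_list_sat[of "SF \<union> SA" "?G # As" "NF \<union> NA" M'] skolem_fresh(2)
    by (auto simp: Un_commute)
  \<comment> \<open>The way back to \<open>M\<close>: a clause without Skolem symbols and without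
    \<open>ans\<close> cannot tell \<open>M''\<close> from \<open>M\<close>. It serves both the
    additional assumptions and \<open>C\<close>.\<close>
  have cl_M'': "holds_cl M'' e' D \<longleftrightarrow> holds_cl M e' D"
    if "(SA \<union> SF) \<inter> funs_cl D = {}" "ans \<notin> preds_cl D" for D e'
    by (rule holds_cl_cong) (use M''(1) that in \<open>auto simp: agree_off_def M'_def\<close>)
  have "\<forall>D\<in>set Cs. models_cl M'' D"
    using M cl_M'' skolem_fresh(4) ans_fresh(3) by (simp add: models_cl_def)
  then have "models_cl M'' (add_mset (LPos (Pred ans [r])) C)"
    using derivable_sound[OF sound derived] M''(2) by blast
  then consider "holds_cl M'' e C" | "pred_of M'' ans [eval M'' e r]"
    by (auto simp: models_cl_def holds_cl_def)
  then show "holds_cl M e C \<or> holds M e (subst_var y r ?F)"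
  proof cases
    case 1
    then show ?thesis using cl_M'' no_skolem C_no_ans by blast
  next
    case 2
    \<comment> \<open>As \<open>r\<close> has no Skolem symbols from \<open>SA\<close> or
      \<open>SF\<close>, the true literal \<open>ans(r)\<close> says that \<open>?F\<close> holds in
      \<open>M\<close> at \<open>e\<close> with \<open>y\<close> set to the value of
      \<open>r\<close>, which is the substituted formula by \<open>holds_subst_var\<close>.\<close>
    have "eval M'' e r = eval M e r"
      by (rule eval_cong) (use M''(1) no_skolem in \<open>auto simp: agree_off_def M'_def\<close>)
    moreover have "pred_of M'' = pred_of M'" using M''(1) by (simp add: agree_off_def)
    ultimately show ?thesis using 2 by (simp add: M'_def holds_subst_var)
  qed
qed

end
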